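(* Let $H$ be a dense solid subgroup of a locally solid commutative $\ell$-group $(G,\tau)$ and let $\sigma=\tau|_H$ be the topology induced by $\tau$ on $H$. Then $\mathfrak{u}\tau=\tau$ if and only if $\mathfrak{u}\sigma=\sigma$.
   Context: A subset $A$ of an $\ell$-group (lattice-ordered group) $G$ is solid if $a\in A$, $x\in G$ and $|x|\le|a|$ imply $x\in A$; a solid subgroup is a subgroup that is solid. $G_+:=\{a\in G:a\ge0\}$. A group topology on $G$ is locally solid if $0$ has a neighbourhood base consisting of solid sets; $(G,\tau)$ is a locally solid commutative $\ell$-group if $G$ is a commutative $\ell$-group and $\tau$ is a locally solid group topology on it. For a locally solid commutative $\ell$-group $(G,\tau)$, $\mathfrak{u}\tau$ denotes the locally solid group topology on $G$ having as a $0$-neighbourhood base the sets $\{x\in G:|x|\wedge a\in U\}$, where $a\in G_+$ and $U$ is a $0$-neighbourhood of $\tau$. Equivalently, $x_\gamma\to x$ with respect to $\mathfrak{u}\tau$ iff $|x_\gamma-x|\wedge a\to0$ in $\tau$ for every $a\in G_+$. The topology $\mathfrak{u}\sigma$ on $H$ is defined in the same way from $(H,\sigma)$, using $a\in H_+$. *)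

theory Defs
  imports "HOL-Analysis.Analysis" "HOL-Library.Lattice_Algebras"
begin

text \<open>
  A commutative lattice-ordered group is a type of class
  \<^class>\<open>lattice_ab_group_add_abs\<close>, where the absolute value of a is the supremum of
  a and -a.  Since the theorem also needs the lattice-ordered group structure of a subgroup, with
  a topology of its own, the topological notions are defined for an abstract topology whose
  \<^const>\<open>topspace\<close> is the underlying set of the group.  No Hausdorff axiom is imposed.
\<close>

definition subgrp :: "'a::ab_group_add set \<Rightarrow> bool"
  where "subgrp S \<longleftrightarrow> 0 \<in> S \<and> (\<forall>x\<in>S. \<forall>y\<in>S. x + y \<in> S) \<and> (\<forall>x\<in>S. - x \<in> S)"

definition lattice_subgrp :: "'a::lattice_ab_group_add_abs set \<Rightarrow> bool"
  where "lattice_subgrp S \<longleftrightarrow> subgrp S \<and> (\<forall>x\<in>S. \<forall>y\<in>S. sup x y \<in> S \<and> inf x y \<in> S)"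

definition solid_in :: "'a::lattice_ab_group_add_abs set \<Rightarrow> 'a set \<Rightarrow> bool"
  where "solid_in S A \<longleftrightarrow> A \<subseteq> S \<and> (\<forall>a\<in>A. \<forall>x\<in>S. \<bar>x\<bar> \<le> \<bar>a\<bar> \<longrightarrow> x \<in> A)"

definition solid_subgrp :: "'a::lattice_ab_group_add_abs set \<Rightarrow> bool"
  where "solid_subgrp H \<longleftrightarrow> subgrp H \<and> solid_in UNIV H"

definition group_topology :: "'a::ab_group_add topology \<Rightarrow> bool"
  where "group_topology \<tau> \<longleftrightarrow>
    subgrp (topspace \<tau>) \<and>
    continuous_map (prod_topology \<tau> \<tau>) \<tau> (\<lambda>(x, y). x + y) \<and>
    continuous_map \<tau> \<tau> uminus"

definition locally_solid_lgroup :: "'a::lattice_ab_group_add_abs topology \<Rightarrow> bool"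
  where "locally_solid_lgroup \<tau> \<longleftrightarrow>
    lattice_subgrp (topspace \<tau>) \<and> group_topology \<tau> \<and>
    neighbourhood_base_at 0 (solid_in (topspace \<tau>)) \<tau>"

definition zero_nbhd :: "'a::zero topology \<Rightarrow> 'a set \<Rightarrow> bool"
  where "zero_nbhd \<tau> U \<longleftrightarrow> U \<subseteq> topspace \<tau> \<and> (\<exists>T. openin \<tau> T \<and> 0 \<in> T \<and> T \<subseteq> U)"

lemma subgrp_diff: "subgrp S \<Longrightarrow> x \<in> S \<Longrightarrow> y \<in> S \<Longrightarrow> x - y \<in> S"
  unfolding diff_conv_add_uminus subgrp_def by blast

lemma lattice_subgrp_abs: "lattice_subgrp S \<Longrightarrow> x \<in> S \<Longrightarrow> \<bar>x\<bar> \<in> S"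
  by (simp add: lattice_subgrp_def subgrp_def abs_lattice)

lemma solid_subgrp_imp_lattice_subgrp:
  assumes "solid_subgrp H" shows "lattice_subgrp H"
proof -
  have g: "subgrp H" and s: "\<And>a x. a \<in> H \<Longrightarrow> \<bar>x\<bar> \<le> \<bar>a\<bar> \<Longrightarrow> x \<in> H"
    using assms by (auto simp: solid_subgrp_def solid_in_def)
  have pos: "sup x 0 \<in> H" if "x \<in> H" for x
  proof (rule s[OF that])
    have "sup x 0 \<le> \<bar>x\<bar>" by (simp add: abs_ge_self)
    then show "\<bar>sup x 0\<bar> \<le> \<bar>x\<bar>" by (simp add: abs_of_nonneg)
  qed
  have sup: "sup x y \<in> H" if "x \<in> H" "y \<in> H" for x y
  proof -
    have "sup x y = sup (x - y) 0 + y" by (simp add: add_sup_distrib_right)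
    then show ?thesis using pos subgrp_diff[OF g] that g by (simp add: subgrp_def)
  qed
  have "inf x y \<in> H" if "x \<in> H" "y \<in> H" for x y
  proof -
    have "- sup (- x) (- y) \<in> H" using sup[of "- x" "- y"] that g unfolding subgrp_def by blast
    then show ?thesis by (simp only: inf_eq_neg_sup[of x y])
  qed
  with g sup show ?thesis by (simp add: lattice_subgrp_def)
qed

lemma locally_solid_lgroup_subtopology:
  assumes "locally_solid_lgroup \<tau>" "topspace \<tau> = UNIV" "solid_subgrp H"
  shows "locally_solid_lgroup (subtopology \<tau> H)"
proof -
  have H: "lattice_subgrp H" using assms(3) by (rule solid_subgrp_imp_lattice_subgrp)
  then have g: "subgrp H" by (simp add: lattice_subgrp_def)
  have gt: "group_topology \<tau>" and nb: "neighbourhood_base_at 0 (solid_in UNIV) \<tau>"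
    using assms(1,2) by (simp_all add: locally_solid_lgroup_def)
  have pr: "prod_topology (subtopology \<tau> H) (subtopology \<tau> H)
      = subtopology (prod_topology \<tau> \<tau>) (H \<times> H)"
    by (simp add: subtopology_Times)
  have "group_topology (subtopology \<tau> H)"
    unfolding group_topology_def
  proof (intro conjI)
    show "subgrp (topspace (subtopology \<tau> H))" using g assms(2) by simp
    have "continuous_map (subtopology (prod_topology \<tau> \<tau>) (H \<times> H)) \<tau> (\<lambda>(x, y). x + y)"
      using gt unfolding group_topology_def by (intro continuous_map_from_subtopology) simp
    moreover have "(\<lambda>(x, y). x + y) ` (H \<times> H) \<subseteq> H" using g by (auto simp: subgrp_def)
    ultimately show "continuous_map (prod_topology (subtopology \<tau> H) (subtopology \<tau> H))
        (subtopology \<tau> H) (\<lambda>(x, y). x + y)"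
      unfolding pr continuous_map_in_subtopology by auto
    have "continuous_map (subtopology \<tau> H) \<tau> uminus"
      using gt unfolding group_topology_def by (intro continuous_map_from_subtopology) simp
    moreover have "uminus ` H \<subseteq> H" using g by (auto simp: subgrp_def)
    ultimately show "continuous_map (subtopology \<tau> H) (subtopology \<tau> H) uminus"
      unfolding continuous_map_in_subtopology by auto
  qed
  moreover have "neighbourhood_base_at 0 (solid_in H) (subtopology \<tau> H)"
    unfolding neighbourhood_base_at_def
  proof (intro allI impI, elim conjE)
    fix W assume "openin (subtopology \<tau> H) W" "0 \<in> W"
    then obtain T where T: "openin \<tau> T" "W = T \<inter> H" "0 \<in> T"
      by (auto simp: openin_subtopology)
    obtain U V where UV: "openin \<tau> U" "solid_in UNIV V" "0 \<in> U" "U \<subseteq> V" "V \<subseteq> T"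
      using nb[unfolded neighbourhood_base_at_def, rule_format, of T] T(1,3) by metis
    have "openin (subtopology \<tau> H) (U \<inter> H)" using UV(1) by (rule openin_subtopology_Int)
    moreover have "solid_in H (V \<inter> H)" using UV(2) unfolding solid_in_def by blast
    moreover have "0 \<in> U \<inter> H" using UV(3) g by (simp add: subgrp_def)
    moreover have "U \<inter> H \<subseteq> V \<inter> H" "V \<inter> H \<subseteq> W" using UV(4,5) T(2) by blast+
    ultimately show "\<exists>U V. openin (subtopology \<tau> H) U \<and> solid_in H V \<and> 0 \<in> U \<and> U \<subseteq> V \<and> V \<subseteq> W"
      by (intro exI[of _ "U \<inter> H"] exI[of _ "V \<inter> H"]) simp
  qed
  ultimately show ?thesis using H assms(2) by (simp add: locally_solid_lgroup_def)
qed

lemma zero_nbhd_Int: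
  assumes "zero_nbhd \<tau> U" "zero_nbhd \<tau> V"
  shows "zero_nbhd \<tau> (U \<inter> V)"
proof -
  obtain A B where "openin \<tau> A" "0 \<in> A" "A \<subseteq> U" "openin \<tau> B" "0 \<in> B" "B \<subseteq> V"
    using assms unfolding zero_nbhd_def by auto
  then have "openin \<tau> (A \<inter> B) \<and> 0 \<in> A \<inter> B \<and> A \<inter> B \<subseteq> U \<inter> V" by auto
  moreover have "U \<inter> V \<subseteq> topspace \<tau>" using assms(1) unfolding zero_nbhd_def by auto
  ultimately show ?thesis unfolding zero_nbhd_def by (intro conjI exI[of _ "A \<inter> B"]) auto
qed

lemma zero_nbhd_solid:
  assumes "locally_solid_lgroup \<tau>" "zero_nbhd \<tau> U"
  obtains V where "zero_nbhd \<tau> V" "V \<subseteq> U" "solid_in (topspace \<tau>) V"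
proof -
  obtain T where T: "openin \<tau> T" "0 \<in> T" "T \<subseteq> U" using assms(2) by (auto simp: zero_nbhd_def)
  have "neighbourhood_base_at 0 (solid_in (topspace \<tau>)) \<tau>"
    using assms(1) by (simp add: locally_solid_lgroup_def)
  then obtain W V where V: "openin \<tau> W" "solid_in (topspace \<tau>) V" "0 \<in> W" "W \<subseteq> V" "V \<subseteq> T"
    using T(1,2) unfolding neighbourhood_base_at_def by metis
  show ?thesis
  proof (rule that)
    show "zero_nbhd \<tau> V" using V(1,3,4) V(2)[unfolded solid_in_def] unfolding zero_nbhd_def by (intro conjI exI[of _ W]) auto
    show "V \<subseteq> U" using V(5) T(3) by (rule order_trans)
  qed (fact V(2))
qed

lemma zero_nbhd_add:
  assumes "group_topology \<tau>" "zero_nbhd \<tau> U"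
  obtains V where "zero_nbhd \<tau> V" "\<And>x y. x \<in> V \<Longrightarrow> y \<in> V \<Longrightarrow> x + y \<in> U"
proof -
  obtain T where T: "openin \<tau> T" "0 \<in> T" "T \<subseteq> U" using assms(2) by (auto simp: zero_nbhd_def)
  let ?P = "{z \<in> topspace (prod_topology \<tau> \<tau>). (case z of (x, y) \<Rightarrow> x + y) \<in> T}"
  have "openin (prod_topology \<tau> \<tau>) ?P"
    using assms(1) T(1) unfolding group_topology_def
    by (intro openin_continuous_map_preimage[where Y = \<tau>]) blast+
  moreover have "(0, 0) \<in> ?P"
    using T assms(1) by (auto simp: group_topology_def subgrp_def)
  ultimately obtain A B where AB: "openin \<tau> A" "openin \<tau> B" "0 \<in> A" "0 \<in> B" "A \<times> B \<subseteq> ?P"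
    using openin_prod_topology_alt[THEN iffD1, rule_format, of \<tau> \<tau> ?P 0 0] by blast
  show ?thesis
  proof (rule that[of "A \<inter> B"])
    show "zero_nbhd \<tau> (A \<inter> B)"
      using AB(3,4) openin_Int[OF AB(1,2)] openin_subset[OF AB(1)] unfolding zero_nbhd_def by blast
    show "x + y \<in> U" if "x \<in> A \<inter> B" "y \<in> A \<inter> B" for x y
      using that AB(5) T(3) by auto
  qed
qed

text \<open>
  The translation-invariant topology on S in which the translates x + N, for N in B, form a
  neighbourhood base at x.  The locale below collects the usual conditions on B under which this
  is a group topology with neighbourhood base B at 0.
\<close>

definition topology_from_zero_base :: "'a::ab_group_add set \<Rightarrow> 'a set set \<Rightarrow> 'a topology"
  where "topology_from_zero_base S B =
    topology (\<lambda>W. W \<subseteq> S \<and> (\<forall>x\<in>W. \<exists>N\<in>B. (+) x ` N \<subseteq> W))"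

locale zero_base =
  fixes S :: "'a::ab_group_add set" and B :: "'a set set"
  assumes S: "subgrp S"
    and ne: "B \<noteq> {}"
    and sub: "N \<in> B \<Longrightarrow> N \<subseteq> S"
    and zero: "N \<in> B \<Longrightarrow> 0 \<in> N"
    and int: "M \<in> B \<Longrightarrow> N \<in> B \<Longrightarrow> \<exists>K\<in>B. K \<subseteq> M \<inter> N"
    and add: "N \<in> B \<Longrightarrow> \<exists>M\<in>B. \<forall>x\<in>M. \<forall>y\<in>M. x + y \<in> N"
    and minus: "N \<in> B \<Longrightarrow> \<exists>M\<in>B. \<forall>x\<in>M. - x \<in> N"
begin

abbreviation "T \<equiv> topology_from_zero_base S B"

lemma openin_iff: "openin T W \<longleftrightarrow> W \<subseteq> S \<and> (\<forall>x\<in>W. \<exists>N\<in>B. \<forall>y\<in>N. x + y \<in> W)"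
proof -
  have "istopology (\<lambda>W. W \<subseteq> S \<and> (\<forall>x\<in>W. \<exists>N\<in>B. (+) x ` N \<subseteq> W))"
    unfolding istopology_def
  proof (intro conjI allI impI)
    fix U V
    assume U: "U \<subseteq> S \<and> (\<forall>x\<in>U. \<exists>N\<in>B. (+) x ` N \<subseteq> U)"
      and V: "V \<subseteq> S \<and> (\<forall>x\<in>V. \<exists>N\<in>B. (+) x ` N \<subseteq> V)"
    show "U \<inter> V \<subseteq> S" using conjunct1[OF U] by (rule le_infI1)
    show "\<forall>x\<in>U \<inter> V. \<exists>N\<in>B. (+) x ` N \<subseteq> U \<inter> V"
    proof
      fix x assume x: "x \<in> U \<inter> V"
      obtain M where M: "M \<in> B" "(+) x ` M \<subseteq> U" using bspec[OF conjunct2[OF U], of x] x by auto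
      obtain N where N: "N \<in> B" "(+) x ` N \<subseteq> V" using bspec[OF conjunct2[OF V], of x] x by auto
      obtain K where K: "K \<in> B" "K \<subseteq> M \<inter> N" using int[OF M(1) N(1)] by auto
      have "(+) x ` K \<subseteq> U \<inter> V" using M(2) N(2) K(2) by (auto simp: image_subset_iff)
      with K(1) show "\<exists>N\<in>B. (+) x ` N \<subseteq> U \<inter> V" by (intro bexI)
    qed
  next
    fix \<K> assume *: "\<forall>K\<in>\<K>. K \<subseteq> S \<and> (\<forall>x\<in>K. \<exists>N\<in>B. (+) x ` N \<subseteq> K)"
    show "\<Union>\<K> \<subseteq> S" by (rule Union_least) (use * in simp)
    show "\<forall>x\<in>\<Union>\<K>. \<exists>N\<in>B. (+) x ` N \<subseteq> \<Union>\<K>"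
    proof
      fix x assume "x \<in> \<Union>\<K>"
      then obtain K where K: "K \<in> \<K>" "x \<in> K" by auto
      obtain N where N: "N \<in> B" "(+) x ` N \<subseteq> K"
        using bspec[OF conjunct2[OF bspec[OF * K(1)]] K(2)] by auto
      have "(+) x ` N \<subseteq> \<Union>\<K>" using N(2) Union_upper[OF K(1)] by (rule order_trans)
      with N(1) show "\<exists>N\<in>B. (+) x ` N \<subseteq> \<Union>\<K>" by (intro bexI)
    qed
  qed
  then show ?thesis
    by (simp add: topology_from_zero_base_def topology_inverse' image_subset_iff)
qed

lemma topspace: "topspace T = S"
proof
  show "topspace T \<subseteq> S" using openin_topspace[of T] unfolding openin_iff by blast
  obtain N where "N \<in> B" using ne by blast
  then have "x + y \<in> S" if "x \<in> S" "y \<in> N" for x y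
    using sub that S unfolding subgrp_def by blast
  then have "openin T S" using \<open>N \<in> B\<close> unfolding openin_iff by blast
  then show "S \<subseteq> topspace T" by (rule openin_subset)
qed

lemma interior:
  assumes "A \<subseteq> S"
  shows "openin T {x \<in> S. \<exists>M\<in>B. \<forall>y\<in>M. x + y \<in> A}" (is "openin T ?I")
proof -
  have "\<exists>N\<in>B. \<forall>y\<in>N. x + y \<in> ?I" if x: "x \<in> ?I" for x
  proof -
    obtain M where M: "M \<in> B" "\<forall>y\<in>M. x + y \<in> A" using x by blast
    obtain N where N: "N \<in> B" "\<forall>x\<in>N. \<forall>y\<in>N. x + y \<in> M" using add[OF M(1)] by blast
    have "x + y \<in> ?I" if "y \<in> N" for y
    proof -
      have "x + y \<in> S" using x that sub[OF N(1)] S by (auto simp: subgrp_def)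
      moreover have "\<forall>z\<in>N. x + y + z \<in> A" using M N that by (simp add: add.assoc)
      ultimately show ?thesis using N(1) by blast
    qed
    with N(1) show ?thesis by blast
  qed
  then show ?thesis unfolding openin_iff by blast
qed

lemma nbhd_iff:
  assumes "x \<in> S" "A \<subseteq> S"
  shows "(\<exists>W. openin T W \<and> x \<in> W \<and> W \<subseteq> A) \<longleftrightarrow> (\<exists>N\<in>B. \<forall>y\<in>N. x + y \<in> A)"
proof
  assume "\<exists>W. openin T W \<and> x \<in> W \<and> W \<subseteq> A"
  then show "\<exists>N\<in>B. \<forall>y\<in>N. x + y \<in> A" unfolding openin_iff by blast
next
  let ?I = "{x \<in> S. \<exists>M\<in>B. \<forall>y\<in>M. x + y \<in> A}"
  assume "\<exists>N\<in>B. \<forall>y\<in>N. x + y \<in> A"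
  then have "x \<in> ?I" using assms by simp
  moreover have "?I \<subseteq> A"
  proof
    fix z assume "z \<in> ?I"
    then obtain M where "M \<in> B" "\<forall>y\<in>M. z + y \<in> A" by blast
    then have "z + 0 \<in> A" using zero by blast
    then show "z \<in> A" by simp
  qed
  ultimately show "\<exists>W. openin T W \<and> x \<in> W \<and> W \<subseteq> A" using interior[OF assms(2)] by blast
qed

lemma zero_nbhd_iff: "zero_nbhd T A \<longleftrightarrow> A \<subseteq> S \<and> (\<exists>N\<in>B. N \<subseteq> A)"
proof -
  have "0 \<in> S" using S by (simp add: subgrp_def)
  from nbhd_iff[OF this, of A] show ?thesis
    unfolding zero_nbhd_def topspace by (simp add: subset_iff) blast
qed

lemma group_topology: "group_topology T"
proof -
  have "openin (prod_topology T T) {z \<in> topspace (prod_topology T T). (case z of (x, y) \<Rightarrow> x + y) \<in> W}"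
    if W: "openin T W" for W
    unfolding openin_prod_topology_alt
  proof (intro allI impI)
    fix x y assume "(x, y) \<in> {z \<in> topspace (prod_topology T T). (case z of (x, y) \<Rightarrow> x + y) \<in> W}"
    then have xy: "x \<in> S" "y \<in> S" "x + y \<in> W" by (auto simp: topspace)
    obtain N where N: "N \<in> B" "\<forall>z\<in>N. x + y + z \<in> W" using W xy(3) unfolding openin_iff by blast
    obtain M where M: "M \<in> B" "\<forall>x\<in>M. \<forall>y\<in>M. x + y \<in> N" using add[OF N(1)] by blast
    have nb: "\<exists>V. openin T V \<and> u \<in> V \<and> V \<subseteq> (+) u ` M" if "u \<in> S" for u
      using that M(1) sub[OF M(1)] S by (subst nbhd_iff) (auto simp: subgrp_def)
    obtain V V' where V: "openin T V" "x \<in> V" "V \<subseteq> (+) x ` M"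
      and V': "openin T V'" "y \<in> V'" "V' \<subseteq> (+) y ` M"
      using nb[OF xy(1)] nb[OF xy(2)] by blast
    have "v + v' \<in> W" if v: "v \<in> V" "v' \<in> V'" for v v'
    proof -
      obtain m m' where "m \<in> M" "v = x + m" "m' \<in> M" "v' = y + m'" using v V V' by blast
      moreover from this have "x + y + (m + m') \<in> W" using M(2) N(2) by blast
      ultimately show ?thesis by (simp add: algebra_simps)
    qed
    then have "V \<times> V' \<subseteq> {z \<in> topspace (prod_topology T T). (case z of (x, y) \<Rightarrow> x + y) \<in> W}"
      using openin_subset[OF V(1)] openin_subset[OF V'(1)] by auto
    with V V' show "\<exists>U V. openin T U \<and> openin T V \<and> x \<in> U \<and> y \<in> V \<and>
        U \<times> V \<subseteq> {z \<in> topspace (prod_topology T T). (case z of (x, y) \<Rightarrow> x + y) \<in> W}" by blast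
  qed
  then have "continuous_map (prod_topology T T) T (\<lambda>(x, y). x + y)"
    using S by (auto simp: continuous_map_def topspace subgrp_def)
  moreover have "openin T {x \<in> topspace T. - x \<in> W}" if W: "openin T W" for W
    unfolding openin_iff
  proof (intro conjI ballI)
    show "{x \<in> topspace T. - x \<in> W} \<subseteq> S" by (auto simp: topspace)
    fix x assume x: "x \<in> {x \<in> topspace T. - x \<in> W}"
    then obtain N where N: "N \<in> B" "\<forall>z\<in>N. - x + z \<in> W" using W unfolding openin_iff by blast
    obtain M where M: "M \<in> B" "\<forall>x\<in>M. - x \<in> N" using minus[OF N(1)] by blast
    have "x + y \<in> {x \<in> topspace T. - x \<in> W}" if "y \<in> M" for y
    proof -
      have "x + y \<in> S" using x that sub[OF M(1)] S by (auto simp: topspace subgrp_def)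
      moreover have "- x + - y \<in> W" using M N that by blast
      ultimately show ?thesis by (simp add: topspace algebra_simps)
    qed
    with M(1) show "\<exists>N\<in>B. \<forall>y\<in>N. x + y \<in> {x \<in> topspace T. - x \<in> W}" by blast
  qed
  then have "continuous_map T T uminus"
    using S by (auto simp: continuous_map_def topspace subgrp_def)
  ultimately show ?thesis using S by (simp add: group_topology_def topspace)
qed

end

definition unbounded_zero_base :: "'a::lattice_ab_group_add_abs topology \<Rightarrow> 'a set set"
  where "unbounded_zero_base \<tau> =
    {{x \<in> topspace \<tau>. inf \<bar>x\<bar> a \<in> U} |a U. a \<in> topspace \<tau> \<and> 0 \<le> a \<and> zero_nbhd \<tau> U}"

definition unbounded_topology :: "'a::lattice_ab_group_add_abs topology \<Rightarrow> 'a topology"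
  where "unbounded_topology \<tau> = topology_from_zero_base (topspace \<tau>) (unbounded_zero_base \<tau>)"

lemma inf_add_le:
  fixes x y a :: "'a::lattice_ab_group_add_abs"
  assumes "0 \<le> x" "0 \<le> y" "0 \<le> a"
  shows "inf (x + y) a \<le> inf x a + inf y a"
proof -
  have "inf x a + inf y a = inf (inf (x + y) (a + y)) (inf (x + a) (a + a))"
    by (simp add: add_inf_distrib_left add_inf_distrib_right)
  moreover have "inf (x + y) a \<le> inf (inf (x + y) (a + y)) (inf (x + a) (a + a))"
    using assms by (auto intro!: le_infI intro: le_infI2 simp: add_increasing add_increasing2)
  ultimately show ?thesis by simp
qed

lemma solid_basic_zero_set:
  fixes \<tau> :: "'a::lattice_ab_group_add_abs topology"
  assumes "locally_solid_lgroup \<tau>" "solid_in (topspace \<tau>) V" "a \<in> topspace \<tau>" "0 \<le> a"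
    and x: "x \<in> topspace \<tau>" "y \<in> topspace \<tau>" "\<bar>y\<bar> \<le> \<bar>x\<bar>" "b \<in> topspace \<tau>" "0 \<le> b" "b \<le> a"
    and V: "inf \<bar>x\<bar> a \<in> V"
  shows "inf \<bar>y\<bar> b \<in> V"
proof -
  have "lattice_subgrp (topspace \<tau>)" using assms by (simp add: locally_solid_lgroup_def)
  then have "inf \<bar>y\<bar> b \<in> topspace \<tau>"
    using x lattice_subgrp_abs[of "topspace \<tau>" y] by (simp add: lattice_subgrp_def)
  moreover have "inf \<bar>y\<bar> b \<le> inf \<bar>x\<bar> a" using x by (intro inf_mono)
  then have "\<bar>inf \<bar>y\<bar> b\<bar> \<le> \<bar>inf \<bar>x\<bar> a\<bar>" using x assms(4) by (simp add: abs_of_nonneg)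
  ultimately show ?thesis using assms(2) V unfolding solid_in_def by blast
qed

lemma zero_base_unbounded:
  fixes \<tau> :: "'a::lattice_ab_group_add_abs topology"
  assumes \<tau>: "locally_solid_lgroup \<tau>"
  shows "zero_base (topspace \<tau>) (unbounded_zero_base \<tau>)"
proof -
  define S where "S = topspace \<tau>"
  have L: "lattice_subgrp S" and G: "subgrp S" and gt: "group_topology \<tau>"
    using \<tau> by (auto simp: S_def locally_solid_lgroup_def lattice_subgrp_def)
  have abs: "\<bar>x\<bar> \<in> S" if "x \<in> S" for x using lattice_subgrp_abs[OF L that] .
  define N where "N a U = {x \<in> S. inf \<bar>x\<bar> a \<in> U}" for a and U :: "'a set"
  have B: "unbounded_zero_base \<tau> = {N a U |a U. a \<in> S \<and> 0 \<le> a \<and> zero_nbhd \<tau> U}"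
    by (simp add: unbounded_zero_base_def N_def S_def)
  have solid: "inf \<bar>y\<bar> b \<in> V"
    if "solid_in S V" "a \<in> S" "0 \<le> a" "x \<in> S" "y \<in> S" "\<bar>y\<bar> \<le> \<bar>x\<bar>" "b \<in> S" "0 \<le> b" "b \<le> a"
      "inf \<bar>x\<bar> a \<in> V" for V a x y b
    using solid_basic_zero_set[OF \<tau>] that unfolding S_def by blast
  have "zero_base S (unbounded_zero_base \<tau>)"
  proof
    show "subgrp S" by (fact G)
    have "zero_nbhd \<tau> S" using G by (auto simp: zero_nbhd_def S_def subgrp_def)
    then show "unbounded_zero_base \<tau> \<noteq> {}" using G unfolding B subgrp_def by blast
    show "M \<subseteq> S" if "M \<in> unbounded_zero_base \<tau>" for M using that unfolding B N_def by blast
    show "0 \<in> M" if "M \<in> unbounded_zero_base \<tau>" for M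
      using that G unfolding B N_def zero_nbhd_def by (auto simp: subgrp_def inf_absorb1)
    show "\<exists>K\<in>unbounded_zero_base \<tau>. K \<subseteq> M \<inter> M'"
      if M: "M \<in> unbounded_zero_base \<tau>" "M' \<in> unbounded_zero_base \<tau>" for M M'
    proof -
      obtain a U b U' where a: "a \<in> S" "0 \<le> a" "zero_nbhd \<tau> U" "M = N a U"
        and b: "b \<in> S" "0 \<le> b" "zero_nbhd \<tau> U'" "M' = N b U'" using M unfolding B by blast
      obtain V where V: "zero_nbhd \<tau> V" "V \<subseteq> U \<inter> U'" "solid_in S V"
        using zero_nbhd_solid[OF \<tau> zero_nbhd_Int[OF a(3) b(3)]] unfolding S_def by blast
      let ?c = "sup a b"
      have c: "?c \<in> S" "0 \<le> ?c" using L a b by (auto simp: lattice_subgrp_def le_supI1)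
      have "N ?c V \<subseteq> M \<inter> M'"
      proof
        fix x assume x: "x \<in> N ?c V"
        then have "inf \<bar>x\<bar> a \<in> V" "inf \<bar>x\<bar> b \<in> V"
          using solid[OF V(3) c, of x x a] solid[OF V(3) c, of x x b] a b by (auto simp: N_def)
        then show "x \<in> M \<inter> M'" using x V(2) a b by (auto simp: N_def)
      qed
      then show ?thesis using c V(1) unfolding B by blast
    qed
    show "\<exists>K\<in>unbounded_zero_base \<tau>. \<forall>x\<in>K. \<forall>y\<in>K. x + y \<in> M" if M: "M \<in> unbounded_zero_base \<tau>" for M
    proof -
      obtain a U where a: "a \<in> S" "0 \<le> a" "zero_nbhd \<tau> U" "M = N a U" using M unfolding B by blast
      obtain U' where U': "zero_nbhd \<tau> U'" "U' \<subseteq> U" "solid_in S U'"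
        using zero_nbhd_solid[OF \<tau> a(3)] unfolding S_def by blast
      obtain V where V: "zero_nbhd \<tau> V" "\<And>x y. x \<in> V \<Longrightarrow> y \<in> V \<Longrightarrow> x + y \<in> U'"
        using zero_nbhd_add[OF gt U'(1)] by blast
      have "x + y \<in> M" if x: "x \<in> N a V" "y \<in> N a V" for x y
      proof -
        have xy: "x \<in> S" "y \<in> S" "x + y \<in> S" using x G by (auto simp: N_def subgrp_def)
        have "inf \<bar>x\<bar> a + inf \<bar>y\<bar> a \<in> U'" using x V(2) by (simp add: N_def)
        moreover have le: "inf \<bar>x + y\<bar> a \<le> inf \<bar>x\<bar> a + inf \<bar>y\<bar> a"
          using a(2) by (rule order_trans[OF inf_mono[OF abs_triangle_ineq order_refl] inf_add_le[OF abs_ge_zero abs_ge_zero]])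
        moreover have "inf \<bar>x + y\<bar> a \<in> S" using L abs xy a by (simp add: lattice_subgrp_def)
        ultimately have "inf \<bar>x + y\<bar> a \<in> U'"
        proof -
          have "0 \<le> inf \<bar>x + y\<bar> a" using a(2) by simp
          moreover from this have "0 \<le> inf \<bar>x\<bar> a + inf \<bar>y\<bar> a" using le by (rule order_trans)
          ultimately have "\<bar>inf \<bar>x + y\<bar> a\<bar> \<le> \<bar>inf \<bar>x\<bar> a + inf \<bar>y\<bar> a\<bar>"
            using le by (simp only: abs_of_nonneg)
          then show ?thesis
            using U'(3) \<open>inf \<bar>x\<bar> a + inf \<bar>y\<bar> a \<in> U'\<close> \<open>inf \<bar>x + y\<bar> a \<in> S\<close>
            unfolding solid_in_def by simp
        qed
        then show ?thesis using U'(2) a xy by (auto simp: N_def)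
      qed
      then show ?thesis using a V(1) unfolding B by blast
    qed
    show "\<exists>K\<in>unbounded_zero_base \<tau>. \<forall>x\<in>K. - x \<in> M" if M: "M \<in> unbounded_zero_base \<tau>" for M
    proof (rule bexI[OF _ M])
      show "\<forall>x\<in>M. - x \<in> M" using M G unfolding B N_def by (auto simp: subgrp_def)
    qed
  qed
  then show ?thesis by (simp add: S_def)
qed

text \<open>
  For a locally solid topology, the unbounded topology is a locally solid group topology with the
  intended neighbourhood base at 0 and the intended convergence.
\<close>

lemma topspace_unbounded_topology:
  "locally_solid_lgroup \<tau> \<Longrightarrow> topspace (unbounded_topology \<tau>) = topspace \<tau>"
  unfolding unbounded_topology_def by (intro zero_base.topspace zero_base_unbounded)

lemma zero_nbhd_unbounded_topology_iff:
  assumes "locally_solid_lgroup \<tau>"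
  shows "zero_nbhd (unbounded_topology \<tau>) A \<longleftrightarrow> A \<subseteq> topspace \<tau> \<and>
    (\<exists>a\<in>topspace \<tau>. 0 \<le> a \<and> (\<exists>U. zero_nbhd \<tau> U \<and> {x \<in> topspace \<tau>. inf \<bar>x\<bar> a \<in> U} \<subseteq> A))"
proof -
  have "(\<exists>N\<in>unbounded_zero_base \<tau>. N \<subseteq> A) \<longleftrightarrow>
    (\<exists>a\<in>topspace \<tau>. 0 \<le> a \<and> (\<exists>U. zero_nbhd \<tau> U \<and> {x \<in> topspace \<tau>. inf \<bar>x\<bar> a \<in> U} \<subseteq> A))"
    unfolding unbounded_zero_base_def
  proof (intro iffI; elim bexE exE conjE CollectE)
    fix N a U
    assume "N \<subseteq> A" "N = {x \<in> topspace \<tau>. inf \<bar>x\<bar> a \<in> U}" "a \<in> topspace \<tau>" "0 \<le> a" "zero_nbhd \<tau> U"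
    then show "\<exists>a\<in>topspace \<tau>. 0 \<le> a \<and> (\<exists>U. zero_nbhd \<tau> U \<and> {x \<in> topspace \<tau>. inf \<bar>x\<bar> a \<in> U} \<subseteq> A)"
      by (intro bexI[of _ a] conjI exI[of _ U]) simp_all
  next
    fix a U
    assume "a \<in> topspace \<tau>" "0 \<le> a" "zero_nbhd \<tau> U" "{x \<in> topspace \<tau>. inf \<bar>x\<bar> a \<in> U} \<subseteq> A"
    then show "\<exists>N\<in>{{x \<in> topspace \<tau>. inf \<bar>x\<bar> a \<in> U} |a U. a \<in> topspace \<tau> \<and> 0 \<le> a \<and> zero_nbhd \<tau> U}. N \<subseteq> A"
      by (intro bexI[of _ "{x \<in> topspace \<tau>. inf \<bar>x\<bar> a \<in> U}"] CollectI exI[of _ a] exI[of _ U] conjI refl)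
  qed
  then show ?thesis
    by (simp only: unbounded_topology_def zero_base.zero_nbhd_iff[OF zero_base_unbounded[OF assms]])
qed

lemma locally_solid_lgroup_unbounded_topology:
  assumes \<tau>: "locally_solid_lgroup \<tau>"
  shows "locally_solid_lgroup (unbounded_topology \<tau>)"
proof -
  let ?S = "topspace \<tau>" and ?u = "unbounded_topology \<tau>"
  have "neighbourhood_base_at 0 (solid_in ?S) ?u"
    unfolding neighbourhood_base_at_def
  proof (intro allI impI)
    fix W assume W: "openin ?u W \<and> 0 \<in> W"
    then have "zero_nbhd ?u W" using openin_subset unfolding zero_nbhd_def by blast
    then obtain a U where a: "a \<in> ?S" "0 \<le> a" "zero_nbhd \<tau> U" "{x \<in> ?S. inf \<bar>x\<bar> a \<in> U} \<subseteq> W"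
      unfolding zero_nbhd_unbounded_topology_iff[OF \<tau>] by blast
    obtain V where V: "zero_nbhd \<tau> V" "V \<subseteq> U" "solid_in ?S V" by (rule zero_nbhd_solid[OF \<tau> a(3)])
    let ?A = "{x \<in> ?S. inf \<bar>x\<bar> a \<in> V}"
    have "zero_nbhd ?u ?A" unfolding zero_nbhd_unbounded_topology_iff[OF \<tau>] using a V by blast
    moreover have "solid_in ?S ?A" unfolding solid_in_def
      using solid_basic_zero_set[OF \<tau> V(3) a(1,2)] a by auto
    moreover have "?A \<subseteq> W" using V a by blast
    ultimately show "\<exists>U V. openin ?u U \<and> solid_in ?S V \<and> 0 \<in> U \<and> U \<subseteq> V \<and> V \<subseteq> W"
      unfolding zero_nbhd_def by blast
  qed
  moreover have "group_topology ?u"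
    unfolding unbounded_topology_def by (rule zero_base.group_topology[OF zero_base_unbounded[OF \<tau>]])
  ultimately show ?thesis
    using \<tau> by (simp add: locally_solid_lgroup_def topspace_unbounded_topology)
qed

lemma limitin_unbounded_topology_iff:
  assumes \<tau>: "locally_solid_lgroup \<tau>"
    and x: "x \<in> topspace \<tau>" and f: "\<And>i. f i \<in> topspace \<tau>"
  shows "limitin (unbounded_topology \<tau>) f x F \<longleftrightarrow>
    (\<forall>a\<in>topspace \<tau>. 0 \<le> a \<longrightarrow> limitin \<tau> (\<lambda>i. inf \<bar>f i - x\<bar> a) 0 F)" (is "?l \<longleftrightarrow> ?r")
proof -
  let ?S = "topspace \<tau>" and ?u = "unbounded_topology \<tau>"
  interpret zero_base ?S "unbounded_zero_base \<tau>" by (rule zero_base_unbounded[OF \<tau>])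
  have u: "?u = T" by (simp add: unbounded_topology_def)
  have z: "0 \<in> ?S" using S by (simp add: subgrp_def)
  show ?thesis
  proof
    assume l: ?l
    show ?r
    proof (intro ballI impI)
      fix a assume a: "a \<in> ?S" "0 \<le> a"
      show "limitin \<tau> (\<lambda>i. inf \<bar>f i - x\<bar> a) 0 F"
        unfolding limitin_def
      proof (intro conjI allI impI z)
        fix U assume "openin \<tau> U \<and> 0 \<in> U"
        then have "zero_nbhd \<tau> U" using openin_subset by (auto simp: zero_nbhd_def)
        then have N: "{y \<in> ?S. inf \<bar>y\<bar> a \<in> U} \<in> unbounded_zero_base \<tau>"
          using a unfolding unbounded_zero_base_def by blast
        let ?A = "{y \<in> ?S. y - x \<in> {y \<in> ?S. inf \<bar>y\<bar> a \<in> U}}"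
        have "\<exists>W. openin T W \<and> x \<in> W \<and> W \<subseteq> ?A"
        proof (rule nbhd_iff[THEN iffD2, OF x])
          have "x + y \<in> ?A" if "y \<in> {y \<in> ?S. inf \<bar>y\<bar> a \<in> U}" for y
            using that x S unfolding subgrp_def by simp
          then show "\<exists>N\<in>unbounded_zero_base \<tau>. \<forall>y\<in>N. x + y \<in> ?A" using N by blast
        qed blast
        then obtain W where W: "openin T W" "x \<in> W" "W \<subseteq> ?A" by blast
        then have "eventually (\<lambda>i. f i \<in> W) F" using l unfolding u limitin_def by blast
        then show "eventually (\<lambda>i. inf \<bar>f i - x\<bar> a \<in> U) F"
          by (rule eventually_mono) (use W in blast)
      qed
    qed
  next
    assume r: ?r
    show ?l
      unfolding u limitin_def topspace
    proof (intro conjI allI impI x)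
      fix W assume "openin T W \<and> x \<in> W"
      then obtain N where "N \<in> unbounded_zero_base \<tau>" "\<forall>y\<in>N. x + y \<in> W" unfolding openin_iff by blast
      then obtain a U where a: "a \<in> ?S" "0 \<le> a" "zero_nbhd \<tau> U"
        "\<And>y. y \<in> ?S \<Longrightarrow> inf \<bar>y\<bar> a \<in> U \<Longrightarrow> x + y \<in> W" unfolding unbounded_zero_base_def by blast
      then obtain V where V: "openin \<tau> V" "0 \<in> V" "V \<subseteq> U" unfolding zero_nbhd_def by blast
      then have "eventually (\<lambda>i. inf \<bar>f i - x\<bar> a \<in> V) F" using r a unfolding limitin_def by blast
      then show "eventually (\<lambda>i. f i \<in> W) F"
      proof (rule eventually_mono)
        fix i assume "inf \<bar>f i - x\<bar> a \<in> V"
        then have "x + (f i - x) \<in> W" using V a(4)[of "f i - x"] subgrp_diff[OF S f x] by blast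
        then show "f i \<in> W" by simp
      qed
    qed
  qed
qed

end

theory Submission
  imports Defs
begin

text \<open>
  A group topology is determined by its zero neighbourhoods, so both equalities say that every zero
  neighbourhood U contains a set of all x with inf |x| a in V.  By density, the bounds a and the
  points x can be moved from the whole group into H and back at the cost of a small error, because,
  for a nonnegative, inf |x| a is bounded both by inf |y| a + |x - y| and by inf |x| |b| + |a - b|.
\<close>

text \<open>The map \<open>f\<close> is kept general so that one lemma serves translations
  (\<open>f\<close> the identity) and reflections \<open>a - x\<close> (\<open>f\<close> the
  negation).\<close>

lemma continuous_map_translation:
  assumes "group_topology \<tau>" "a \<in> topspace \<tau>" "continuous_map \<tau> \<tau> f"
  shows "continuous_map \<tau> \<tau> (\<lambda>x. a + f x)"
proof -
  have "continuous_map \<tau> (prod_topology \<tau> \<tau>) (\<lambda>x. (a, f x))"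
    using assms(2,3) by (simp add: continuous_map_pairwise o_def)
  from continuous_map_compose[OF this, of \<tau> "\<lambda>(x, y). x + y"] show ?thesis
    using assms(1) by (simp add: group_topology_def o_def)
qed

text \<open>Translations by \<open>x\<close> and by \<open>- x\<close> are both continuous, so the
  neighbourhoods of \<open>x\<close> are exactly the translates of those of 0. Hence a group
  topology can be recovered from its zero neighbourhoods.\<close>

lemma openin_group_topology_iff:
  assumes "group_topology \<tau>"
  shows "openin \<tau> W \<longleftrightarrow>
    W \<subseteq> topspace \<tau> \<and> (\<forall>x\<in>W. zero_nbhd \<tau> {y \<in> topspace \<tau>. x + y \<in> W})" (is "_ \<longleftrightarrow> ?r")
proof
  have S: "subgrp (topspace \<tau>)" using assms by (simp add: group_topology_def)
  have shift: "openin \<tau> {y \<in> topspace \<tau>. a + y \<in> A}" if "openin \<tau> A" "a \<in> topspace \<tau>" for a A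
    using openin_continuous_map_preimage
      [OF continuous_map_translation[OF assms that(2) continuous_map_id] that(1)]
    by simp
  show ?r if W: "openin \<tau> W"
  proof (intro conjI ballI)
    show "W \<subseteq> topspace \<tau>" using W by (rule openin_subset)
    fix x assume x: "x \<in> W"
    have "0 \<in> topspace \<tau>" using S by (simp add: subgrp_def)
    then show "zero_nbhd \<tau> {y \<in> topspace \<tau>. x + y \<in> W}"
      using shift[OF W, of x] x \<open>W \<subseteq> topspace \<tau>\<close> unfolding zero_nbhd_def
      by (intro conjI exI[of _ "{y \<in> topspace \<tau>. x + y \<in> W}"]) auto
  qed
  show "openin \<tau> W" if r: ?r
  proof (subst openin_subopen, intro ballI)
    fix x assume x: "x \<in> W"
    then obtain T where T: "openin \<tau> T" "0 \<in> T" "T \<subseteq> {y \<in> topspace \<tau>. x + y \<in> W}"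
      using r unfolding zero_nbhd_def by blast
    have xS: "x \<in> topspace \<tau>" "- x \<in> topspace \<tau>" using x r S unfolding subgrp_def by blast+
    \<comment> \<open>This is the translate \<open>x + T\<close>, written as a preimage under
      translation by \<open>- x\<close> so that continuity makes it open.\<close>
    let ?A = "{y \<in> topspace \<tau>. - x + y \<in> T}"
    have "openin \<tau> ?A" using T(1) xS(2) by (rule shift)
    moreover have "x \<in> ?A" using T(2) xS by simp
    moreover have "?A \<subseteq> W"
    proof
      fix y assume "y \<in> ?A"
      then have "x + (- x + y) \<in> W" using T(3) by blast
      then show "y \<in> W" by simp
    qed
    ultimately show "\<exists>A. openin \<tau> A \<and> x \<in> A \<and> A \<subseteq> W" by blast
  qed
qed

lemma group_topology_eq_iff:
  assumes "group_topology \<tau>" "group_topology \<sigma>" "topspace \<tau> = topspace \<sigma>"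
  shows "\<tau> = \<sigma> \<longleftrightarrow> (\<forall>U. zero_nbhd \<tau> U \<longleftrightarrow> zero_nbhd \<sigma> U)"
proof
  assume r: "\<forall>U. zero_nbhd \<tau> U \<longleftrightarrow> zero_nbhd \<sigma> U"
  show "\<tau> = \<sigma>"
    unfolding topology_eq openin_group_topology_iff[OF assms(1)] openin_group_topology_iff[OF assms(2)]
    using assms(3) r by simp
qed simp

text \<open>The unbounded topology is always coarser:
  \<open>inf \<bar>x\<bar> a \<le> \<bar>x\<bar>\<close>, so truncating by \<open>a\<close> does not
  leave a solid zero neighbourhood. Equality therefore amounts to the other inclusion between the
  zero neighbourhoods.\<close>

lemma unbounded_topology_eq_iff:
  assumes \<tau>: "locally_solid_lgroup \<tau>"
  shows "unbounded_topology \<tau> = \<tau> \<longleftrightarrow>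
    (\<forall>U. zero_nbhd \<tau> U \<longrightarrow> (\<exists>a\<in>topspace \<tau>. 0 \<le> a \<and>
      (\<exists>V. zero_nbhd \<tau> V \<and> {x \<in> topspace \<tau>. inf \<bar>x\<bar> a \<in> V} \<subseteq> U)))"
proof -
  have L: "lattice_subgrp (topspace \<tau>)" and g: "group_topology \<tau>"
    using \<tau> by (auto simp: locally_solid_lgroup_def)
  have gu: "group_topology (unbounded_topology \<tau>)"
    using locally_solid_lgroup_unbounded_topology[OF \<tau>] by (simp add: locally_solid_lgroup_def)
  have coarser: "zero_nbhd \<tau> U" if "zero_nbhd (unbounded_topology \<tau>) U" for U
  proof -
    obtain a V where a: "U \<subseteq> topspace \<tau>" "a \<in> topspace \<tau>" "0 \<le> a" "zero_nbhd \<tau> V"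
      "{x \<in> topspace \<tau>. inf \<bar>x\<bar> a \<in> V} \<subseteq> U"
      using \<open>zero_nbhd (unbounded_topology \<tau>) U\<close>
      unfolding zero_nbhd_unbounded_topology_iff[OF \<tau>] by blast
    obtain W where W: "zero_nbhd \<tau> W" "W \<subseteq> V" "solid_in (topspace \<tau>) W"
      by (rule zero_nbhd_solid[OF \<tau> a(4)])
    have "W \<subseteq> U"
    proof
      fix x assume x: "x \<in> W"
      then have xS: "x \<in> topspace \<tau>" using W(3) by (auto simp: solid_in_def)
      then have "inf \<bar>x\<bar> a \<in> topspace \<tau>"
        using L a(2) lattice_subgrp_abs[OF L] by (simp add: lattice_subgrp_def)
      moreover have "\<bar>inf \<bar>x\<bar> a\<bar> \<le> \<bar>x\<bar>" using a(3) by (simp add: abs_of_nonneg)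
      ultimately have "inf \<bar>x\<bar> a \<in> W" using W(3) x by (auto simp: solid_in_def)
      then show "x \<in> U" using W(2) a(5) xS by blast
    qed
    then show ?thesis using W(1) a(1) unfolding zero_nbhd_def by blast
  qed
  have "unbounded_topology \<tau> = \<tau> \<longleftrightarrow>
      (\<forall>U. zero_nbhd \<tau> U \<longrightarrow> zero_nbhd (unbounded_topology \<tau>) U)"
    using group_topology_eq_iff[OF gu g topspace_unbounded_topology[OF \<tau>]] coarser by blast
  also have "\<dots> \<longleftrightarrow> (\<forall>U. zero_nbhd \<tau> U \<longrightarrow> (\<exists>a\<in>topspace \<tau>. 0 \<le> a \<and>
      (\<exists>V. zero_nbhd \<tau> V \<and> {x \<in> topspace \<tau>. inf \<bar>x\<bar> a \<in> V} \<subseteq> U)))"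
    unfolding zero_nbhd_unbounded_topology_iff[OF \<tau>] by (auto simp: zero_nbhd_def)
  finally show ?thesis .
qed

text \<open>Three shrinkings are nested: the innermost solid set allows passing to absolute values,
  the middle one allows adding two of them, and the outer solid set absorbs everything dominated by
  the sum. Each estimate with an error term below is turned into membership this way.\<close>

lemma zero_nbhd_solid_add:
  assumes \<tau>: "locally_solid_lgroup \<tau>" and U: "zero_nbhd \<tau> U"
  obtains V where "zero_nbhd \<tau> V"
    "\<And>x y z. x \<in> V \<Longrightarrow> y \<in> V \<Longrightarrow> z \<in> topspace \<tau> \<Longrightarrow> \<bar>z\<bar> \<le> \<bar>x\<bar> + \<bar>y\<bar> \<Longrightarrow> z \<in> U"
proof -
  have L: "lattice_subgrp (topspace \<tau>)" and g: "group_topology \<tau>"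
    using \<tau> by (auto simp: locally_solid_lgroup_def)
  obtain W where W: "zero_nbhd \<tau> W" "W \<subseteq> U" "solid_in (topspace \<tau>) W"
    by (rule zero_nbhd_solid[OF \<tau> U])
  obtain V' where V': "zero_nbhd \<tau> V'" "\<And>x y. x \<in> V' \<Longrightarrow> y \<in> V' \<Longrightarrow> x + y \<in> W"
    using zero_nbhd_add[OF g W(1)] by blast
  obtain V where V: "zero_nbhd \<tau> V" "V \<subseteq> V'" "solid_in (topspace \<tau>) V"
    by (rule zero_nbhd_solid[OF \<tau> V'(1)])
  have "z \<in> U" if "x \<in> V" "y \<in> V" "z \<in> topspace \<tau>" "\<bar>z\<bar> \<le> \<bar>x\<bar> + \<bar>y\<bar>" for x y z
  proof -
    have abs: "\<bar>u\<bar> \<in> V" if "u \<in> V" for u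
      using V(3) that lattice_subgrp_abs[OF L, of u] by (auto simp: solid_in_def)
    have "\<bar>x\<bar> + \<bar>y\<bar> \<in> W" using abs that V(2) V'(2) by blast
    moreover have "\<bar>z\<bar> \<le> \<bar>\<bar>x\<bar> + \<bar>y\<bar>\<bar>" using that(4) by (simp add: abs_of_nonneg)
    ultimately show ?thesis using W(2,3) that(3) unfolding solid_in_def by blast
  qed
  with V(1) show ?thesis by (rule that)
qed

lemma zero_nbhd_subtopology_iff:
  assumes "0 \<in> H"
  shows "zero_nbhd (subtopology \<tau> H) A \<longleftrightarrow>
    A \<subseteq> topspace \<tau> \<inter> H \<and> (\<exists>U. zero_nbhd \<tau> U \<and> U \<inter> H \<subseteq> A)"
proof
  assume "zero_nbhd (subtopology \<tau> H) A"
  then obtain T where T: "A \<subseteq> topspace \<tau> \<inter> H" "openin \<tau> T" "0 \<in> T" "T \<inter> H \<subseteq> A"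
    by (auto simp: zero_nbhd_def openin_subtopology)
  then have "zero_nbhd \<tau> T" using openin_subset by (auto simp: zero_nbhd_def)
  with T show "A \<subseteq> topspace \<tau> \<inter> H \<and> (\<exists>U. zero_nbhd \<tau> U \<and> U \<inter> H \<subseteq> A)" by blast
next
  assume "A \<subseteq> topspace \<tau> \<inter> H \<and> (\<exists>U. zero_nbhd \<tau> U \<and> U \<inter> H \<subseteq> A)"
  then obtain U where U: "A \<subseteq> topspace \<tau> \<inter> H" "zero_nbhd \<tau> U" "U \<inter> H \<subseteq> A" by iprover
  then obtain T where T: "openin \<tau> T" "0 \<in> T" "T \<subseteq> U" by (auto simp: zero_nbhd_def)
  have "T \<inter> H \<subseteq> A" using T(3) U(3) by blast
  then show "zero_nbhd (subtopology \<tau> H) A"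
    using U(1) T assms openin_subtopology_Int[of \<tau> T H] unfolding zero_nbhd_def
    by (intro conjI exI[of _ "T \<inter> H"]) simp_all
qed

text \<open>The reflection \<open>y\<close> to \<open>x - y\<close> is continuous and sends
  \<open>x\<close> to 0, so the preimage of an open zero neighbourhood is an open set around
  \<open>x\<close> and meets \<open>H\<close>.\<close>

lemma closure_of_zero_nbhd:
  assumes g: "group_topology \<tau>" and x: "x \<in> \<tau> closure_of H" and U: "zero_nbhd \<tau> U"
  obtains h where "h \<in> H" "x - h \<in> U"
proof -
  obtain T where T: "openin \<tau> T" "0 \<in> T" "T \<subseteq> U" using U by (auto simp: zero_nbhd_def)
  have xS: "x \<in> topspace \<tau>" using x by (simp add: in_closure_of)
  have "continuous_map \<tau> \<tau> (\<lambda>y. x + - y)"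
    using g xS by (intro continuous_map_translation) (simp_all add: group_topology_def)
  then have A: "openin \<tau> {y \<in> topspace \<tau>. x + - y \<in> T}" (is "openin \<tau> ?A")
    using T(1) by (rule openin_continuous_map_preimage)
  have "x \<in> ?A" using xS T(2) by simp
  moreover have "x \<in> ?A \<and> openin \<tau> ?A \<longrightarrow> (\<exists>h. h \<in> H \<and> h \<in> ?A)"
    using x unfolding in_closure_of by (elim conjE) (erule spec)
  ultimately obtain h where "h \<in> H" "h \<in> ?A" using A by iprover
  then show ?thesis using that[of h] subsetD[OF T(3), of "x - h"] by simp
qed

text \<open>Translation by \<open>y\<close> preserves infima, and it can only raise the bound
  \<open>a\<close>.\<close>

lemma inf_add_le_add:
  fixes x y a :: "'a::lattice_ab_group_add_abs"
  assumes "0 \<le> y"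
  shows "inf (x + y) a \<le> inf x a + y"
proof -
  have "inf (x + y) a \<le> inf (x + y) (a + y)"
    using assms by (intro inf_mono order_refl) simp
  then show ?thesis by (simp add: add_inf_distrib_right)
qed

text \<open>This is the triangle inequality after truncation. Since \<open>a\<close> is arbitrary,
  commutativity of \<open>inf\<close> lets the same estimate control a change of the bound as well
  as a change of the point.\<close>

lemma inf_abs_le_left:
  fixes x y a :: "'a::lattice_ab_group_add_abs"
  shows "inf \<bar>x\<bar> a \<le> inf \<bar>y\<bar> a + \<bar>x - y\<bar>"
proof -
  have "\<bar>x\<bar> \<le> \<bar>y\<bar> + \<bar>x - y\<bar>" using abs_triangle_ineq[of y "x - y"] by simp
  then have "inf \<bar>x\<bar> a \<le> inf (\<bar>y\<bar> + \<bar>x - y\<bar>) a" by (intro inf_mono order_refl)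
  also have "\<dots> \<le> inf \<bar>y\<bar> a + \<bar>x - y\<bar>" by (intro inf_add_le_add) simp
  finally show ?thesis .
qed

theorem theorem5p7:
  fixes \<tau> \<sigma> :: "'a::lattice_ab_group_add_abs topology" and H :: "'a set"
  assumes "topspace \<tau> = UNIV"
    and "locally_solid_lgroup \<tau>"
    and "solid_subgrp H"
    and "\<tau> closure_of H = UNIV"
    and "\<sigma> = subtopology \<tau> H"
  shows "unbounded_topology \<tau> = \<tau> \<longleftrightarrow> unbounded_topology \<sigma> = \<sigma>"
proof -
  note \<tau> = assms(2)
  have g: "group_topology \<tau>" using \<tau> by (simp add: locally_solid_lgroup_def)
  have \<sigma>: "locally_solid_lgroup \<sigma>"
    unfolding assms(5) using assms(2,1,3) by (rule locally_solid_lgroup_subtopology)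
  have L: "lattice_subgrp H" using assms(3) by (rule solid_subgrp_imp_lattice_subgrp)
  then have H0: "0 \<in> H" by (simp add: lattice_subgrp_def subgrp_def)
  have top: "topspace \<sigma> = H" using assms(1,5) by simp
  have \<sigma>_nbhd: "zero_nbhd \<sigma> A \<longleftrightarrow> A \<subseteq> H \<and> (\<exists>U. zero_nbhd \<tau> U \<and> U \<inter> H \<subseteq> A)" for A
    using zero_nbhd_subtopology_iff[OF H0, of \<tau> A] assms(1,5) by simp
  have dense: "\<exists>h\<in>H. x - h \<in> U" if "zero_nbhd \<tau> U" for x U
    using closure_of_zero_nbhd[OF g _ that, of x H] assms(4) by blast
  \<comment> \<open>Both equalities are expressed through zero neighbourhoods of
    \<open>\<tau>\<close> alone. Then \<open>?P\<close> and \<open>?Q\<close> differ only in whether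
    the bound and the points range over the whole group or over \<open>H\<close>.\<close>
  let ?P = "\<forall>U. zero_nbhd \<tau> U \<longrightarrow>
      (\<exists>a\<ge>0. \<exists>V. zero_nbhd \<tau> V \<and> (\<forall>x. inf \<bar>x\<bar> a \<in> V \<longrightarrow> x \<in> U))"
  let ?Q = "\<forall>U. zero_nbhd \<tau> U \<longrightarrow>
      (\<exists>b\<in>H. 0 \<le> b \<and> (\<exists>V. zero_nbhd \<tau> V \<and> (\<forall>x\<in>H. inf \<bar>x\<bar> b \<in> V \<longrightarrow> x \<in> U)))"
  have P: "unbounded_topology \<tau> = \<tau> \<longleftrightarrow> ?P"
    unfolding unbounded_topology_eq_iff[OF \<tau>] assms(1) by (simp add: subset_iff)
  have Q: "unbounded_topology \<sigma> = \<sigma> \<longleftrightarrow> ?Q"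
  proof -
    \<comment> \<open>A neighbourhood for \<open>\<sigma>\<close> is controlled by one for
      \<open>\<tau>\<close> only on \<open>H\<close>, so truncations must be known to stay in
      \<open>H\<close>.\<close>
    have inf_H: "inf \<bar>x\<bar> b \<in> H" if "x \<in> H" "b \<in> H" for x b
      using L that lattice_subgrp_abs[OF L] by (simp add: lattice_subgrp_def)
    have \<sigma>_Int: "zero_nbhd \<sigma> (U \<inter> H)" if "zero_nbhd \<tau> U" for U
      using that \<sigma>_nbhd by blast
    show ?thesis unfolding unbounded_topology_eq_iff[OF \<sigma>] top
    proof (intro iffI allI impI)
      fix U assume l: "\<forall>U. zero_nbhd \<sigma> U \<longrightarrow> (\<exists>a\<in>H. 0 \<le> a \<and>
          (\<exists>V. zero_nbhd \<sigma> V \<and> {x \<in> H. inf \<bar>x\<bar> a \<in> V} \<subseteq> U))" and U: "zero_nbhd \<tau> U"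
      obtain b V where b: "b \<in> H" "0 \<le> b" "zero_nbhd \<sigma> V" "{x \<in> H. inf \<bar>x\<bar> b \<in> V} \<subseteq> U \<inter> H"
        using l \<sigma>_Int[OF U] by blast
      obtain W where W: "zero_nbhd \<tau> W" "W \<inter> H \<subseteq> V" using b(3) \<sigma>_nbhd by blast
      have "\<forall>x\<in>H. inf \<bar>x\<bar> b \<in> W \<longrightarrow> x \<in> U" using b(1,4) W(2) inf_H by blast
      then show "\<exists>b\<in>H. 0 \<le> b \<and> (\<exists>V. zero_nbhd \<tau> V \<and> (\<forall>x\<in>H. inf \<bar>x\<bar> b \<in> V \<longrightarrow> x \<in> U))"
        using b(1,2) W(1) by blast
    next
      fix U assume r: ?Q and "zero_nbhd \<sigma> U"
      then obtain W where W: "zero_nbhd \<tau> W" "W \<inter> H \<subseteq> U" using \<sigma>_nbhd by blast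
      obtain b V where b: "b \<in> H" "0 \<le> b" "zero_nbhd \<tau> V" "\<forall>x\<in>H. inf \<bar>x\<bar> b \<in> V \<longrightarrow> x \<in> W"
        using r W(1) by blast
      have "{x \<in> H. inf \<bar>x\<bar> b \<in> V \<inter> H} \<subseteq> U" using b(4) W(2) by blast
      then show "\<exists>a\<in>H. 0 \<le> a \<and> (\<exists>V. zero_nbhd \<sigma> V \<and> {x \<in> H. inf \<bar>x\<bar> a \<in> V} \<subseteq> U)"
        using b(1,2) \<sigma>_Int[OF b(3)] by blast
    qed
  qed
  have "?P \<longleftrightarrow> ?Q"
  proof (intro iffI allI impI)
    fix U assume ?P and U: "zero_nbhd \<tau> U"
    then obtain a V where a: "0 \<le> a" "zero_nbhd \<tau> V" "\<And>x. inf \<bar>x\<bar> a \<in> V \<Longrightarrow> x \<in> U" by blast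
    obtain W where W: "zero_nbhd \<tau> W"
      "\<And>x y z. x \<in> W \<Longrightarrow> y \<in> W \<Longrightarrow> \<bar>z\<bar> \<le> \<bar>x\<bar> + \<bar>y\<bar> \<Longrightarrow> z \<in> V"
      using zero_nbhd_solid_add[OF \<tau> a(2)] assms(1) by auto
    \<comment> \<open>The approximant \<open>h\<close> of the bound \<open>a\<close> may fail to be
      nonnegative; \<open>\<bar>h\<bar>\<close> replaces it as the new bound.\<close>
    obtain h where h: "h \<in> H" "a - h \<in> W" using dense[OF W(1)] by blast
    have "x \<in> U" if x: "inf \<bar>x\<bar> \<bar>h\<bar> \<in> W" for x
    proof (rule a(3), rule W(2)[OF x h(2)])
      \<comment> \<open>The roles are swapped here: \<open>a\<close> and \<open>h\<close> are the
        points being compared, and \<open>\<bar>x\<bar>\<close> is the truncating bound.\<close>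
      have "inf a \<bar>x\<bar> \<le> inf \<bar>h\<bar> \<bar>x\<bar> + \<bar>a - h\<bar>" 
        using inf_abs_le_left[of a "\<bar>x\<bar>" h] a(1) by (simp add: abs_of_nonneg)
      then show "\<bar>inf \<bar>x\<bar> a\<bar> \<le> \<bar>inf \<bar>x\<bar> \<bar>h\<bar>\<bar> + \<bar>a - h\<bar>"
        using a(1) by (simp add: abs_of_nonneg inf_commute)
    qed
    then show "\<exists>b\<in>H. 0 \<le> b \<and> (\<exists>V. zero_nbhd \<tau> V \<and> (\<forall>x\<in>H. inf \<bar>x\<bar> b \<in> V \<longrightarrow> x \<in> U))"
      using W(1) lattice_subgrp_abs[OF L h(1)] by (intro bexI[of _ "\<bar>h\<bar>"] conjI exI[of _ W]) auto
  next
    fix U assume q: ?Q and U: "zero_nbhd \<tau> U"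
    obtain W where W: "zero_nbhd \<tau> W"
      "\<And>x y z. x \<in> W \<Longrightarrow> y \<in> W \<Longrightarrow> \<bar>z\<bar> \<le> \<bar>x\<bar> + \<bar>y\<bar> \<Longrightarrow> z \<in> U"
      using zero_nbhd_solid_add[OF \<tau> U] assms(1) by auto
    obtain b V where b: "b \<in> H" "0 \<le> b" "zero_nbhd \<tau> V" "\<And>x. x \<in> H \<Longrightarrow> inf \<bar>x\<bar> b \<in> V \<Longrightarrow> x \<in> W"
      using q W(1) by blast
    obtain V' where V': "zero_nbhd \<tau> V'"
      "\<And>x y z. x \<in> V' \<Longrightarrow> y \<in> V' \<Longrightarrow> \<bar>z\<bar> \<le> \<bar>x\<bar> + \<bar>y\<bar> \<Longrightarrow> z \<in> V"
      using zero_nbhd_solid_add[OF \<tau> b(3)] assms(1) by auto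
    have "x \<in> U" if x: "inf \<bar>x\<bar> b \<in> V'" for x
    proof -
      \<comment> \<open>The bound \<open>b\<close> stays fixed and the point moves. Closeness in
        \<open>V'\<close> brings the truncation of \<open>h\<close> into \<open>V\<close>, so that
        \<open>h \<in> W\<close> by the choice of \<open>b\<close> and \<open>V\<close>; closeness
        in \<open>W\<close> then leads back from \<open>h\<close> to
        \<open>x \<in> U\<close>.\<close>
      obtain h where h: "h \<in> H" "x - h \<in> W" "x - h \<in> V'"
        using dense[OF zero_nbhd_Int[OF W(1) V'(1)]] by blast
      have "\<bar>inf \<bar>h\<bar> b\<bar> \<le> \<bar>inf \<bar>x\<bar> b\<bar> + \<bar>x - h\<bar>"
        using inf_abs_le_left[of h b x] b(2) by (simp add: abs_of_nonneg abs_minus_commute)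
      then have "h \<in> W" using V'(2)[OF x h(3)] b(4)[OF h(1)] by blast
      moreover have "\<bar>x\<bar> \<le> \<bar>h\<bar> + \<bar>x - h\<bar>" using abs_triangle_ineq[of h "x - h"] by simp
      ultimately show ?thesis using W(2) h(2) by blast
    qed
    then show "\<exists>a\<ge>0. \<exists>V. zero_nbhd \<tau> V \<and> (\<forall>x. inf \<bar>x\<bar> a \<in> V \<longrightarrow> x \<in> U)"
      using b(2) V'(1) by blast
  qed
  with P Q show ?thesis by simp
qed

end
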